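(* Let $(T,\mu,\eta)$ be an ordered saturation monad on $\mathsf{Set}$ such that arbitrary cotupling in $\mathcal{K}l(T)$ is monotonic and $T$ weakly lax preserves pullbacks. Then for every $\alpha:X\to TX$, the greatest weak bisimulation $\approx_*$ on $\alpha$ coincides with the greatest strong (Aczel–Mendler) bisimulation on $\alpha^*:X\to TX$.
   Context: Kleisli category $\mathcal{K}l(T)$: morphisms $X\rightsquigarrow Y$ are maps $X\to TY$, composition $g\cdot f=\mu_Z\circ Tg\circ f$, identity $1_X=\eta_X$; $f^\sharp=\eta_Y\circ f$. Ordered saturation monad: $\mathcal{K}l(T)$ order enriched and for each $\alpha:X\rightsquigarrow X$ there is $\alpha^*$ with (1) $1\le\alpha^*$; (2) $\alpha\le\alpha^*$; (3) $\alpha^*\cdot\alpha^*\le\alpha^*$; (4) $\alpha^*\le\beta$ whenever $1\le\beta$, $\alpha\le\beta$, $\beta\cdot\beta\le\beta$; (5) for any map $f:X\to Y$ and $\beta:Y\rightsquigarrow Y$, $f^\sharp\cdot\alpha\le\beta\cdot f^\sharp\Rightarrow f^\sharp\cdot\alpha^*\le\beta^*\cdot f^\sharp$, and likewise with $\ge$. Weak bisimulation on $\alpha$: symmetric $R\subseteq X\times X$ with some $\gamma:R\to TR$ such that $\alpha\cdot\pi_1^\sharp\le\pi_1^\sharp\cdot\gamma$ and $\pi_2^\sharp\cdot\gamma\le\alpha^*\cdot\pi_2^\sharp$. A strong bisimulation on $\beta:X\to TX$ is a relation $R\subseteq X\times X$ with some $\gamma:R\to TR$ such that $T\pi_i\circ\gamma=\beta\circ\pi_i$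 for $i=1,2$. Cotupling monotonic: $f_i\le g_i$ for all $i$ implies $[\{f_i\}]\le[\{g_i\}]$ in $\mathcal{K}l(T)$. Weakly lax preserving pullbacks: for every pullback $P$ (projections $p_1,p_2$) of $A\xrightarrow{f}C\xleftarrow{g}B$, the $T$-image square is a weak pullback and for any $q_1:Z\to TA$, $q_2:Z\to TB$ with $Tf\circ q_1\le Tg\circ q_2$ there is $\xi:Z\to TP$ with $q_1\le Tp_1\circ\xi$ and $Tp_2\circ\xi\le q_2$. *)

theory Defs
  imports "HOL-Library.FuncSet"
begin

text \<open>
  Since HOL cannot quantify over type constructors, the category of sets is rendered by its
  small objects: the objects are the small sets of elements of a universe type, the
  maps from \<open>A\<close> to \<open>B\<close> are the elements of \<open>A \<rightarrow>\<^sub>E B\<close> (so that equality of maps is equality in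
  HOL), and composition of maps with domain \<open>A\<close> is \<open>compose A\<close>.

  Only those closure properties are required that make the (co)limits occurring below available.
  Every Grothendieck universe is an instance, and so is every infinite type with all of
  its subsets small.
\<close>

class set_universe =
  fixes small :: "'a set \<Rightarrow> bool"
    and pair :: "'a \<Rightarrow> 'a \<Rightarrow> 'a"
  assumes pair_inject: "pair a b = pair c d \<longleftrightarrow> a = c \<and> b = d"
    and small_subset: "small A \<Longrightarrow> B \<subseteq> A \<Longrightarrow> small B"
    and small_doubleton: "small {a, b}"
    and small_UN: "small I \<Longrightarrow> (\<And>i. i \<in> I \<Longrightarrow> small (X i)) \<Longrightarrow> small (\<Union>i\<in>I. X i)"

definition pfst :: "'u::set_universe \<Rightarrow> 'u" where
  "pfst p = (THE a. \<exists>b. p = pair a b)"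

definition psnd :: "'u::set_universe \<Rightarrow> 'u" where
  "psnd p = (THE b. \<exists>a. p = pair a b)"

definition id_map :: "'u set \<Rightarrow> 'u \<Rightarrow> 'u" where
  "id_map A = (\<lambda>x\<in>A. x)"


definition coprod :: "'u::set_universe set \<Rightarrow> ('u \<Rightarrow> 'u set) \<Rightarrow> 'u set" where
  "coprod I X = {pair i x | i x. i \<in> I \<and> x \<in> X i}"

definition cotuple ::
  "'u::set_universe set \<Rightarrow> ('u \<Rightarrow> 'u set) \<Rightarrow> ('u \<Rightarrow> 'u \<Rightarrow> 'u) \<Rightarrow> 'u \<Rightarrow> 'u" where
  "cotuple I X f = (\<lambda>p\<in>coprod I X. f (pfst p) (psnd p))"

text \<open>The square consists of \<open>p1 : P \<rightarrow> A\<close>, \<open>p2 : P \<rightarrow> B\<close>, \<open>f : A \<rightarrow> C\<close> and \<open>g : B \<rightarrow> C\<close>.\<close>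

definition commuting_square ::
  "'u::set_universe set \<Rightarrow> 'u set \<Rightarrow> 'u set \<Rightarrow> 'u set \<Rightarrow>
   ('u \<Rightarrow> 'u) \<Rightarrow> ('u \<Rightarrow> 'u) \<Rightarrow> ('u \<Rightarrow> 'u) \<Rightarrow> ('u \<Rightarrow> 'u) \<Rightarrow> bool" where
  "commuting_square P A B C p1 p2 f g \<longleftrightarrow>
     small P \<and> small A \<and> small B \<and> small C \<and>
     p1 \<in> P \<rightarrow>\<^sub>E A \<and> p2 \<in> P \<rightarrow>\<^sub>E B \<and> f \<in> A \<rightarrow>\<^sub>E C \<and> g \<in> B \<rightarrow>\<^sub>E C \<and>
     compose P f p1 = compose P g p2"

definition weak_pullback ::
  "'u::set_universe set \<Rightarrow> 'u set \<Rightarrow> 'u set \<Rightarrow> 'u set \<Rightarrow>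
   ('u \<Rightarrow> 'u) \<Rightarrow> ('u \<Rightarrow> 'u) \<Rightarrow> ('u \<Rightarrow> 'u) \<Rightarrow> ('u \<Rightarrow> 'u) \<Rightarrow> bool" where
  "weak_pullback P A B C p1 p2 f g \<longleftrightarrow>
     commuting_square P A B C p1 p2 f g \<and>
     (\<forall>(Z :: 'u set) q1 q2. small Z \<longrightarrow> q1 \<in> Z \<rightarrow>\<^sub>E A \<longrightarrow> q2 \<in> Z \<rightarrow>\<^sub>E B \<longrightarrow> compose Z f q1 = compose Z g q2 \<longrightarrow>
        (\<exists>u. u \<in> Z \<rightarrow>\<^sub>E P \<and> compose Z p1 u = q1 \<and> compose Z p2 u = q2))"

definition pullback ::
  "'u::set_universe set \<Rightarrow> 'u set \<Rightarrow> 'u set \<Rightarrow> 'u set \<Rightarrow>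
   ('u \<Rightarrow> 'u) \<Rightarrow> ('u \<Rightarrow> 'u) \<Rightarrow> ('u \<Rightarrow> 'u) \<Rightarrow> ('u \<Rightarrow> 'u) \<Rightarrow> bool" where
  "pullback P A B C p1 p2 f g \<longleftrightarrow>
     commuting_square P A B C p1 p2 f g \<and>
     (\<forall>(Z :: 'u set) q1 q2. small Z \<longrightarrow> q1 \<in> Z \<rightarrow>\<^sub>E A \<longrightarrow> q2 \<in> Z \<rightarrow>\<^sub>E B \<longrightarrow> compose Z f q1 = compose Z g q2 \<longrightarrow>
        (\<exists>!u. u \<in> Z \<rightarrow>\<^sub>E P \<and> compose Z p1 u = q1 \<and> compose Z p2 u = q2))"


text \<open>
  \<open>Tmap M X Y f\<close> is \<open>T f : T X \<rightarrow> T Y\<close> for \<open>f : X \<rightarrow> Y\<close>; domain and codomain are passed explicitly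
  because a HOL function does not determine them. Likewise \<open>le M X Y\<close> is the order on the
  Kleisli hom-set of maps \<open>X \<rightarrow> T Y\<close>, and \<open>star M X\<close> is the saturation operator on the
  Kleisli endomorphisms of \<open>X\<close>.
\<close>

record 'u monad_data =
  Tob :: "'u set \<Rightarrow> 'u set"
  Tmap :: "'u set \<Rightarrow> 'u set \<Rightarrow> ('u \<Rightarrow> 'u) \<Rightarrow> 'u \<Rightarrow> 'u"
  mu :: "'u set \<Rightarrow> 'u \<Rightarrow> 'u"
  eta :: "'u set \<Rightarrow> 'u \<Rightarrow> 'u"

record 'u saturation_data = "'u monad_data" +
  le :: "'u set \<Rightarrow> 'u set \<Rightarrow> ('u \<Rightarrow> 'u) \<Rightarrow> ('u \<Rightarrow> 'u) \<Rightarrow> bool"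
  star :: "'u set \<Rightarrow> ('u \<Rightarrow> 'u) \<Rightarrow> 'u \<Rightarrow> 'u"

definition kl_hom :: "('u, 'm) monad_data_scheme \<Rightarrow> 'u set \<Rightarrow> 'u set \<Rightarrow> ('u \<Rightarrow> 'u) set" where
  "kl_hom M X Y = X \<rightarrow>\<^sub>E Tob M Y"

text \<open>\<open>kl_comp M X Y Z g f\<close> is \<open>g \<cdot> f\<close> for Kleisli morphisms \<open>f\<close> from \<open>X\<close> to \<open>Y\<close> and \<open>g\<close> from \<open>Y\<close> to \<open>Z\<close>.\<close>

definition kl_comp :: "('u, 'm) monad_data_scheme \<Rightarrow> 'u set \<Rightarrow> 'u set \<Rightarrow> 'u set \<Rightarrow>
    ('u \<Rightarrow> 'u) \<Rightarrow> ('u \<Rightarrow> 'u) \<Rightarrow> 'u \<Rightarrow> 'u" where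
  "kl_comp M X Y Z g f =
     compose X (mu M Z) (compose X (Tmap M Y (Tob M Z) g) f)"

definition sharp :: "('u, 'm) monad_data_scheme \<Rightarrow> 'u set \<Rightarrow> 'u set \<Rightarrow> ('u \<Rightarrow> 'u) \<Rightarrow> 'u \<Rightarrow> 'u" where
  "sharp M X Y f = compose X (eta M Y) f"


locale set_monad =
  fixes M :: "('u::set_universe, 'm) monad_data_scheme"
  assumes Tob_small: "small X \<Longrightarrow> small (Tob M X)"
    and Tmap_hom: "\<lbrakk>small X; small Y; f \<in> X \<rightarrow>\<^sub>E Y\<rbrakk> \<Longrightarrow> Tmap M X Y f \<in> Tob M X \<rightarrow>\<^sub>E Tob M Y"
    and Tmap_id: "small X \<Longrightarrow> Tmap M X X (id_map X) = id_map (Tob M X)"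
    and Tmap_comp: "\<lbrakk>small X; small Y; small Z; f \<in> X \<rightarrow>\<^sub>E Y; g \<in> Y \<rightarrow>\<^sub>E Z\<rbrakk> \<Longrightarrow>
      Tmap M X Z (compose X g f) = compose (Tob M X) (Tmap M Y Z g) (Tmap M X Y f)"
    and eta_hom: "small X \<Longrightarrow> eta M X \<in> X \<rightarrow>\<^sub>E Tob M X"
    and eta_natural: "\<lbrakk>small X; small Y; f \<in> X \<rightarrow>\<^sub>E Y\<rbrakk> \<Longrightarrow>
      compose X (Tmap M X Y f) (eta M X) = compose X (eta M Y) f"
    and mu_hom: "small X \<Longrightarrow> mu M X \<in> Tob M (Tob M X) \<rightarrow>\<^sub>E Tob M X"
    and mu_natural: "\<lbrakk>small X; small Y; f \<in> X \<rightarrow>\<^sub>E Y\<rbrakk> \<Longrightarrow>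
      compose (Tob M (Tob M X)) (Tmap M X Y f) (mu M X) =
      compose (Tob M (Tob M X)) (mu M Y) (Tmap M (Tob M X) (Tob M Y) (Tmap M X Y f))"
    and mu_eta: "small X \<Longrightarrow> compose (Tob M X) (mu M X) (eta M (Tob M X)) = id_map (Tob M X)"
    and mu_Tmap_eta: "small X \<Longrightarrow>
      compose (Tob M X) (mu M X) (Tmap M X (Tob M X) (eta M X)) = id_map (Tob M X)"
    and mu_assoc: "small X \<Longrightarrow>
      compose (Tob M (Tob M (Tob M X))) (mu M X) (mu M (Tob M X)) =
      compose (Tob M (Tob M (Tob M X))) (mu M X) (Tmap M (Tob M (Tob M X)) (Tob M X) (mu M X))"

locale order_enriched_monad = set_monad M
  for M :: "('u::set_universe, 'm) saturation_data_scheme" +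
  assumes le_refl: "\<lbrakk>small X; small Y; f \<in> kl_hom M X Y\<rbrakk> \<Longrightarrow> le M X Y f f"
    and le_antisym: "\<lbrakk>small X; small Y; f \<in> kl_hom M X Y; g \<in> kl_hom M X Y;
      le M X Y f g; le M X Y g f\<rbrakk> \<Longrightarrow> f = g"
    and le_trans: "\<lbrakk>small X; small Y; f \<in> kl_hom M X Y; g \<in> kl_hom M X Y; h \<in> kl_hom M X Y;
      le M X Y f g; le M X Y g h\<rbrakk> \<Longrightarrow> le M X Y f h"
    and kl_comp_mono_left: "\<lbrakk>small X; small Y; small Z; f \<in> kl_hom M X Y;
      g \<in> kl_hom M Y Z; g' \<in> kl_hom M Y Z; le M Y Z g g'\<rbrakk> \<Longrightarrow>
      le M X Z (kl_comp M X Y Z g f) (kl_comp M X Y Z g' f)"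
    and kl_comp_mono_right: "\<lbrakk>small X; small Y; small Z; f \<in> kl_hom M X Y; f' \<in> kl_hom M X Y;
      g \<in> kl_hom M Y Z; le M X Y f f'\<rbrakk> \<Longrightarrow>
      le M X Z (kl_comp M X Y Z g f) (kl_comp M X Y Z g f')"

text \<open>
  The first four \<open>star\<close> properties determine \<open>star\<close> on Kleisli endomorphisms uniquely, so
  carrying it as part of the data imposes no more than its existence.
\<close>

locale ordered_saturation_monad = order_enriched_monad M
  for M :: "('u::set_universe, 'm) saturation_data_scheme" +
  assumes star_hom: "\<lbrakk>small X; \<alpha> \<in> kl_hom M X X\<rbrakk> \<Longrightarrow> star M X \<alpha> \<in> kl_hom M X X"
    and star_refl: "\<lbrakk>small X; \<alpha> \<in> kl_hom M X X\<rbrakk> \<Longrightarrow> le M X X (eta M X) (star M X \<alpha>)"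
    and star_extensive: "\<lbrakk>small X; \<alpha> \<in> kl_hom M X X\<rbrakk> \<Longrightarrow> le M X X \<alpha> (star M X \<alpha>)"
    and star_trans: "\<lbrakk>small X; \<alpha> \<in> kl_hom M X X\<rbrakk> \<Longrightarrow>
      le M X X (kl_comp M X X X (star M X \<alpha>) (star M X \<alpha>)) (star M X \<alpha>)"
    and star_least: "\<lbrakk>small X; \<alpha> \<in> kl_hom M X X; \<beta> \<in> kl_hom M X X;
      le M X X (eta M X) \<beta>; le M X X \<alpha> \<beta>; le M X X (kl_comp M X X X \<beta> \<beta>) \<beta>\<rbrakk> \<Longrightarrow>
      le M X X (star M X \<alpha>) \<beta>"
    and star_lax: "\<lbrakk>small X; small Y; \<alpha> \<in> kl_hom M X X; \<beta> \<in> kl_hom M Y Y; f \<in> X \<rightarrow>\<^sub>E Y;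
      le M X Y (kl_comp M X X Y (sharp M X Y f) \<alpha>) (kl_comp M X Y Y \<beta> (sharp M X Y f))\<rbrakk> \<Longrightarrow>
      le M X Y (kl_comp M X X Y (sharp M X Y f) (star M X \<alpha>))
               (kl_comp M X Y Y (star M Y \<beta>) (sharp M X Y f))"
    and star_oplax: "\<lbrakk>small X; small Y; \<alpha> \<in> kl_hom M X X; \<beta> \<in> kl_hom M Y Y; f \<in> X \<rightarrow>\<^sub>E Y;
      le M X Y (kl_comp M X Y Y \<beta> (sharp M X Y f)) (kl_comp M X X Y (sharp M X Y f) \<alpha>)\<rbrakk> \<Longrightarrow>
      le M X Y (kl_comp M X Y Y (star M Y \<beta>) (sharp M X Y f))
               (kl_comp M X X Y (sharp M X Y f) (star M X \<alpha>))"


text \<open>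
  Coproducts in the Kleisli category are those of the base category, and the Kleisli cotuple of
  maps \<open>X i \<rightarrow> T Y\<close> is their cotuple as plain maps.
\<close>

definition cotupling_monotonic :: "('u::set_universe, 'm) saturation_data_scheme \<Rightarrow> bool" where
  "cotupling_monotonic M \<longleftrightarrow>
     (\<forall>I X Y f g. small I \<longrightarrow> (\<forall>i\<in>I. small (X i)) \<longrightarrow> small Y \<longrightarrow>
        (\<forall>i\<in>I. f i \<in> kl_hom M (X i) Y \<and> g i \<in> kl_hom M (X i) Y \<and> le M (X i) Y (f i) (g i)) \<longrightarrow>
        le M (coprod I X) Y (cotuple I X f) (cotuple I X g))"

definition weakly_lax_preserves_pullbacks ::
  "('u::set_universe, 'm) saturation_data_scheme \<Rightarrow> bool" where
  "weakly_lax_preserves_pullbacks M \<longleftrightarrow>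
     (\<forall>P A B C p1 p2 f g. pullback P A B C p1 p2 f g \<longrightarrow>
        weak_pullback (Tob M P) (Tob M A) (Tob M B) (Tob M C)
          (Tmap M P A p1) (Tmap M P B p2) (Tmap M A C f) (Tmap M B C g) \<and>
        (\<forall>(Z :: 'u set) q1 q2. small Z \<longrightarrow> q1 \<in> Z \<rightarrow>\<^sub>E Tob M A \<longrightarrow> q2 \<in> Z \<rightarrow>\<^sub>E Tob M B \<longrightarrow>
           le M Z C (compose Z (Tmap M A C f) q1) (compose Z (Tmap M B C g) q2) \<longrightarrow>
           (\<exists>\<xi> \<in> Z \<rightarrow>\<^sub>E Tob M P.
              le M Z A q1 (compose Z (Tmap M P A p1) \<xi>) \<and>
              le M Z B (compose Z (Tmap M P B p2) \<xi>) q2)))"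


text \<open>\<open>rel_obj R\<close> is the relation \<open>R\<close> as an object, with projections \<open>\<pi>1 R\<close> and \<open>\<pi>2 R\<close>.\<close>

definition rel_obj :: "('u::set_universe \<times> 'u) set \<Rightarrow> 'u set" where
  "rel_obj R = {pair x y | x y. (x, y) \<in> R}"

definition \<pi>1 :: "('u::set_universe \<times> 'u) set \<Rightarrow> 'u \<Rightarrow> 'u" where
  "\<pi>1 R = (\<lambda>p\<in>rel_obj R. pfst p)"

definition \<pi>2 :: "('u::set_universe \<times> 'u) set \<Rightarrow> 'u \<Rightarrow> 'u" where
  "\<pi>2 R = (\<lambda>p\<in>rel_obj R. psnd p)"

definition weak_bisimulation ::
  "('u::set_universe, 'm) saturation_data_scheme \<Rightarrow> 'u set \<Rightarrow> ('u \<Rightarrow> 'u) \<Rightarrow> ('u \<times> 'u) set \<Rightarrow> bool" where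
  "weak_bisimulation M X \<alpha> R \<longleftrightarrow>
     R \<subseteq> X \<times> X \<and> sym R \<and>
     (\<exists>\<gamma> \<in> rel_obj R \<rightarrow>\<^sub>E Tob M (rel_obj R).
        le M (rel_obj R) X
          (kl_comp M (rel_obj R) X X \<alpha> (sharp M (rel_obj R) X (\<pi>1 R)))
          (kl_comp M (rel_obj R) (rel_obj R) X (sharp M (rel_obj R) X (\<pi>1 R)) \<gamma>) \<and>
        le M (rel_obj R) X
          (kl_comp M (rel_obj R) (rel_obj R) X (sharp M (rel_obj R) X (\<pi>2 R)) \<gamma>)
          (kl_comp M (rel_obj R) X X (star M X \<alpha>) (sharp M (rel_obj R) X (\<pi>2 R))))"

definition strong_bisimulation ::
  "('u::set_universe, 'm) monad_data_scheme \<Rightarrow> 'u set \<Rightarrow> ('u \<Rightarrow> 'u) \<Rightarrow> ('u \<times> 'u) set \<Rightarrow> bool" where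
  "strong_bisimulation M X \<beta> R \<longleftrightarrow>
     R \<subseteq> X \<times> X \<and>
     (\<exists>\<gamma> \<in> rel_obj R \<rightarrow>\<^sub>E Tob M (rel_obj R).
        compose (rel_obj R) (Tmap M (rel_obj R) X (\<pi>1 R)) \<gamma> = compose (rel_obj R) \<beta> (\<pi>1 R) \<and>
        compose (rel_obj R) (Tmap M (rel_obj R) X (\<pi>2 R)) \<gamma> = compose (rel_obj R) \<beta> (\<pi>2 R))"

definition greatest_relation :: "(('u \<times> 'u) set \<Rightarrow> bool) \<Rightarrow> ('u \<times> 'u) set \<Rightarrow> bool" where
  "greatest_relation P R \<longleftrightarrow> P R \<and> (\<forall>S. P S \<longrightarrow> S \<subseteq> R)"

end

theory Submission
  imports Defs
begin

text \<open>
  In the Kleisli category \<open>f\<^sup>\<sharp> \<cdot> \<alpha> = T f \<circ> \<alpha>\<close> and \<open>\<beta> \<cdot> f\<^sup>\<sharp> = \<beta> \<circ> f\<close>. A symmetric strong bisimulation on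
  \<open>\<alpha>\<^sup>*\<close> is a weak bisimulation on \<open>\<alpha>\<close> because \<open>\<alpha> \<le> \<alpha>\<^sup>*\<close>, and the union of all strong bisimulations
  is strong and symmetric. Conversely, let \<open>R\<close> be a weak bisimulation with witness \<open>\<gamma>\<close>, and let \<open>q\<close>
  be the quotient of \<open>X\<close> by the equivalence relation \<open>E\<close> generated by \<open>R\<close>. Then \<open>\<gamma>\<^sup>*\<close> gives
  \<open>T q \<circ> \<alpha>\<^sup>* \<circ> \<pi>\<^sub>1 \<le> T q \<circ> T \<pi>\<^sub>1 \<circ> \<gamma>\<^sup>* = T q \<circ> T \<pi>\<^sub>2 \<circ> \<gamma>\<^sup>* \<le> T q \<circ> \<alpha>\<^sup>* \<circ> \<pi>\<^sub>2\<close> on \<open>R\<close>, and by symmetry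
  of \<open>R\<close> equality holds. So \<open>T q \<circ> \<alpha>\<^sup>*\<close> is constant on the classes of \<open>E\<close>, and since \<open>T\<close> preserves
  the kernel pair of \<open>q\<close> weakly, \<open>E\<close> is a strong bisimulation on \<open>\<alpha>\<^sup>*\<close>.
\<close>

section \<open>Pairs, relations as objects, and kernel pairs\<close>

lemma pfst_pair [simp]: "pfst (pair a b) = a"
  unfolding pfst_def by (auto simp: pair_inject)

lemma psnd_pair [simp]: "psnd (pair a b) = b"
  unfolding psnd_def by (auto simp: pair_inject)

lemma pair_mem_rel_obj [simp]: "pair a b \<in> rel_obj R \<longleftrightarrow> (a, b) \<in> R"
  unfolding rel_obj_def by (auto simp: pair_inject)

lemma rel_objE:
  assumes "p \<in> rel_obj R"
  obtains a b where "p = pair a b" "(a, b) \<in> R"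
  using assms unfolding rel_obj_def by auto

lemma \<pi>1_pair [simp]: "(a, b) \<in> R \<Longrightarrow> \<pi>1 R (pair a b) = a"
  unfolding \<pi>1_def by simp

lemma \<pi>2_pair [simp]: "(a, b) \<in> R \<Longrightarrow> \<pi>2 R (pair a b) = b"
  unfolding \<pi>2_def by simp

lemma \<pi>1_hom: "R \<subseteq> X \<times> X \<Longrightarrow> \<pi>1 R \<in> rel_obj R \<rightarrow>\<^sub>E X"
  unfolding \<pi>1_def by (auto elim!: rel_objE)

lemma \<pi>2_hom: "R \<subseteq> X \<times> X \<Longrightarrow> \<pi>2 R \<in> rel_obj R \<rightarrow>\<^sub>E X"
  unfolding \<pi>2_def by (auto elim!: rel_objE)

text \<open>A binary product is a union of singletons indexed twice over \<open>X\<close>, and a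
  singleton is a degenerate doubleton.\<close>

lemma small_rel_obj:
  assumes "small X" "R \<subseteq> X \<times> X"
  shows "small (rel_obj R)"
proof -
  have sing: "small {a}" for a :: 'a
    using small_doubleton[of a a] by simp
  have "small (\<Union>x\<in>X. \<Union>y\<in>X. {pair x y})"
    by (intro small_UN assms sing)
  moreover have "rel_obj R \<subseteq> (\<Union>x\<in>X. \<Union>y\<in>X. {pair x y})"
    using assms(2) by (auto elim!: rel_objE)
  ultimately show ?thesis
    by (rule small_subset)
qed

lemma compose_PiE: "f \<in> A \<rightarrow>\<^sub>E B \<Longrightarrow> g \<in> B \<rightarrow>\<^sub>E C \<Longrightarrow> compose A g f \<in> A \<rightarrow>\<^sub>E C"
  by (auto simp: compose_def PiE_iff)

lemma compose_eqI:
  "(\<And>x. x \<in> A \<Longrightarrow> g (f x) = g' (f' x)) \<Longrightarrow> compose A g f = compose A g' f'"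
  by (auto simp: compose_def restrict_def)

lemma compose_cong_on:
  "(\<And>x. x \<in> A \<Longrightarrow> g (f x) = h x) \<Longrightarrow> h \<in> extensional A \<Longrightarrow> compose A g f = h"
  by (auto simp: compose_def restrict_def extensional_def)

lemma compose_eqD: "compose A g f = compose A g' f' \<Longrightarrow> x \<in> A \<Longrightarrow> g (f x) = g' (f' x)"
  by (metis compose_eq)

text \<open>This is what allows the hypothesis on pullbacks to be applied to \<open>q\<close>. The
  mediating map pairs \<open>q1\<close> with \<open>q2\<close>; it is unique because an element of
  \<open>rel_obj E\<close> is determined by its two components.\<close>

lemma pullback_kernel_pair:
  fixes X Y :: "'u::set_universe set"
  assumes X: "small X" and Y: "small Y" and q: "q \<in> X \<rightarrow>\<^sub>E Y"
    and E: "E = {(x, y). x \<in> X \<and> y \<in> X \<and> q x = q y}"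
  shows "pullback (rel_obj E) X X Y (\<pi>1 E) (\<pi>2 E) q q"
proof -
  have sub: "E \<subseteq> X \<times> X" using E by auto
  have "compose (rel_obj E) q (\<pi>1 E) = compose (rel_obj E) q (\<pi>2 E)"
    by (rule compose_eqI) (use E in \<open>auto elim!: rel_objE\<close>)
  then have "commuting_square (rel_obj E) X X Y (\<pi>1 E) (\<pi>2 E) q q"
    unfolding commuting_square_def
    using X Y q \<pi>1_hom[OF sub] \<pi>2_hom[OF sub] small_rel_obj[OF X sub] by auto
  moreover have "\<exists>!u. u \<in> Z \<rightarrow>\<^sub>E rel_obj E \<and> compose Z (\<pi>1 E) u = q1 \<and> compose Z (\<pi>2 E) u = q2"
    if q1: "q1 \<in> Z \<rightarrow>\<^sub>E X" and q2: "q2 \<in> Z \<rightarrow>\<^sub>E X" and eq: "compose Z q q1 = compose Z q q2"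
    for Z :: "'u set" and q1 q2
  proof (rule ex1I)
    have inE: "(q1 z, q2 z) \<in> E" if "z \<in> Z" for z
      using compose_eqD[OF eq that] q1 q2 that E by auto
    let ?u = "\<lambda>z\<in>Z. pair (q1 z) (q2 z)"
    show "?u \<in> Z \<rightarrow>\<^sub>E rel_obj E \<and> compose Z (\<pi>1 E) ?u = q1 \<and> compose Z (\<pi>2 E) ?u = q2"
      using q1 q2 by (auto simp: inE PiE_iff intro!: compose_cong_on)
    fix u
    assume u: "u \<in> Z \<rightarrow>\<^sub>E rel_obj E \<and> compose Z (\<pi>1 E) u = q1 \<and> compose Z (\<pi>2 E) u = q2"
    show "u = ?u"
    proof
      fix z
      show "u z = ?u z"
      proof (cases "z \<in> Z")
        case True
        then have "u z \<in> rel_obj E" using u by auto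
        then obtain a b where ab: "u z = pair a b" "(a, b) \<in> E" by (rule rel_objE)
        have "q1 z = \<pi>1 E (u z)" "q2 z = \<pi>2 E (u z)"
          using u True by (auto simp: compose_eq)
        with ab True show ?thesis by simp
      qed (use u in \<open>auto simp: PiE_iff extensional_def\<close>)
    qed
  qed
  ultimately show ?thesis unfolding pullback_def by blast
qed

section \<open>Kleisli composition with plain maps, and closure properties of strong
  bisimulations\<close>

context set_monad
begin

lemma Tmap_comp_apply:
  "\<lbrakk>small X; small Y; small Z; f \<in> X \<rightarrow>\<^sub>E Y; g \<in> Y \<rightarrow>\<^sub>E Z; t \<in> Tob M X\<rbrakk> \<Longrightarrow>
    Tmap M Y Z g (Tmap M X Y f t) = Tmap M X Z (compose X g f) t"
  by (simp add: Tmap_comp compose_eq)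

lemma sharp_hom: "\<lbrakk>small Y; f \<in> X \<rightarrow>\<^sub>E Y\<rbrakk> \<Longrightarrow> sharp M X Y f \<in> kl_hom M X Y"
  unfolding sharp_def kl_hom_def by (rule compose_PiE[OF _ eta_hom])

text \<open>Functoriality splits \<open>T (eta \<circ> f)\<close> into
  \<open>T eta \<circ> T f\<close>, and the unit law \<open>mu_Tmap_eta\<close> cancels
  \<open>T eta\<close> against \<open>mu\<close>.\<close>

lemma kl_comp_sharp_left:
  assumes Y: "small Y" and Z: "small Z" and f: "f \<in> Y \<rightarrow>\<^sub>E Z" and a: "a \<in> X \<rightarrow>\<^sub>E Tob M Y"
  shows "kl_comp M X Y Z (sharp M Y Z f) a = compose X (Tmap M Y Z f) a"
proof -
  have "mu M Z (Tmap M Y (Tob M Z) (compose Y (eta M Z) f) t) = Tmap M Y Z f t"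
    if t: "t \<in> Tob M Y" for t
  proof -
    have Tf: "Tmap M Y Z f t \<in> Tob M Z"
      using Tmap_hom[OF Y Z f] t by auto
    have "mu M Z (Tmap M Y (Tob M Z) (compose Y (eta M Z) f) t)
        = compose (Tob M Z) (mu M Z) (Tmap M Z (Tob M Z) (eta M Z)) (Tmap M Y Z f t)"
      using Tmap_comp_apply[OF Y Z Tob_small[OF Z] f eta_hom[OF Z] t] Tf
      by (simp add: compose_eq)
    also have "\<dots> = Tmap M Y Z f t"
      unfolding mu_Tmap_eta[OF Z] id_map_def using Tf by simp
    finally show ?thesis .
  qed
  then show ?thesis
    unfolding kl_comp_def sharp_def
    by (intro compose_eqI) (use a in \<open>auto simp: compose_eq\<close>)
qed

text \<open>Naturality moves \<open>eta\<close> past \<open>b\<close>, after which the other unit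
  law, \<open>mu_eta\<close>, cancels it.\<close>

lemma kl_comp_sharp_right:
  assumes Y: "small Y" and Z: "small Z" and f: "f \<in> X \<rightarrow>\<^sub>E Y" and b: "b \<in> Y \<rightarrow>\<^sub>E Tob M Z"
  shows "kl_comp M X Y Z b (sharp M X Y f) = compose X b f"
proof -
  have "mu M Z (Tmap M Y (Tob M Z) b (eta M Y y)) = b y" if y: "y \<in> Y" for y
  proof -
    have bty: "b y \<in> Tob M Z" using b y by auto
    have "mu M Z (Tmap M Y (Tob M Z) b (eta M Y y))
        = compose (Tob M Z) (mu M Z) (eta M (Tob M Z)) (b y)"
      using compose_eqD[OF eta_natural[OF Y Tob_small[OF Z] b] y] bty by (simp add: compose_eq)
    also have "\<dots> = b y"
      unfolding mu_eta[OF Z] id_map_def using bty by simp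
    finally show ?thesis .
  qed
  then show ?thesis
    unfolding kl_comp_def sharp_def
    by (intro compose_eqI) (use f in \<open>auto simp: compose_eq\<close>)
qed

text \<open>By choice, a coalgebra structure on \<open>R\<close> amounts to one lift
  \<open>t\<close> for each related pair. Closure properties can then be checked a pair at a time,
  without gluing structure maps.\<close>

lemma strong_bisimulation_pointwise:
  "strong_bisimulation M X b R \<longleftrightarrow> R \<subseteq> X \<times> X \<and>
    (\<forall>(x, y)\<in>R. \<exists>t\<in>Tob M (rel_obj R).
      Tmap M (rel_obj R) X (\<pi>1 R) t = b x \<and> Tmap M (rel_obj R) X (\<pi>2 R) t = b y)"
    (is "_ \<longleftrightarrow> _ \<and> ?lift")
proof (intro iffI conjI)
  assume "strong_bisimulation M X b R"
  then obtain g where sub: "R \<subseteq> X \<times> X" and g: "g \<in> rel_obj R \<rightarrow>\<^sub>E Tob M (rel_obj R)"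
    and g1: "compose (rel_obj R) (Tmap M (rel_obj R) X (\<pi>1 R)) g = compose (rel_obj R) b (\<pi>1 R)"
    and g2: "compose (rel_obj R) (Tmap M (rel_obj R) X (\<pi>2 R)) g = compose (rel_obj R) b (\<pi>2 R)"
    unfolding strong_bisimulation_def by blast
  show "R \<subseteq> X \<times> X" by fact
  show ?lift
  proof clarify
    fix x y assume xy: "(x, y) \<in> R"
    then have p: "pair x y \<in> rel_obj R" by simp
    show "\<exists>t\<in>Tob M (rel_obj R).
      Tmap M (rel_obj R) X (\<pi>1 R) t = b x \<and> Tmap M (rel_obj R) X (\<pi>2 R) t = b y"
      using compose_eqD[OF g1 p] compose_eqD[OF g2 p] PiE_mem[OF g p] xy by auto
  qed
next
  assume "R \<subseteq> X \<times> X \<and> ?lift"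
  then have sub: "R \<subseteq> X \<times> X" and ?lift by auto
  then have "\<forall>p\<in>rel_obj R. \<exists>t. t \<in> Tob M (rel_obj R) \<and>
      Tmap M (rel_obj R) X (\<pi>1 R) t = b (\<pi>1 R p) \<and> Tmap M (rel_obj R) X (\<pi>2 R) t = b (\<pi>2 R p)"
    by (fastforce elim!: rel_objE)
  then obtain g where g: "\<forall>p\<in>rel_obj R. g p \<in> Tob M (rel_obj R) \<and>
      Tmap M (rel_obj R) X (\<pi>1 R) (g p) = b (\<pi>1 R p) \<and>
      Tmap M (rel_obj R) X (\<pi>2 R) (g p) = b (\<pi>2 R p)"
    unfolding bchoice_iff by blast
  then show "strong_bisimulation M X b R"
    unfolding strong_bisimulation_def using sub
    by (intro conjI bexI[of _ "restrict g (rel_obj R)"]) (auto intro!: compose_eqI)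
qed

text \<open>A lift for a member \<open>R\<close> is pushed forward along the inclusion of
  \<open>R\<close> into the union; the projections of \<open>R\<close> factor through that
  inclusion.\<close>

lemma strong_bisimulation_Union:
  assumes X: "small X" and S: "\<And>R. R \<in> \<S> \<Longrightarrow> strong_bisimulation M X b R"
  shows "strong_bisimulation M X b (\<Union>\<S>)"
  unfolding strong_bisimulation_pointwise
proof (intro conjI ballI, safe)
  let ?U = "\<Union>\<S>"
  show sub: "x \<in> X" "y \<in> X" if "(x, y) \<in> R" "R \<in> \<S>" for x y R
    using that S unfolding strong_bisimulation_def by blast+
  fix x y R assume xy: "(x, y) \<in> R" and R: "R \<in> \<S>"
  have subR: "R \<subseteq> X \<times> X" and subU: "?U \<subseteq> X \<times> X" using sub R by auto
  let ?R = "rel_obj R"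
  let ?U' = "rel_obj ?U"
  obtain t where t: "t \<in> Tob M ?R" "Tmap M ?R X (\<pi>1 R) t = b x" "Tmap M ?R X (\<pi>2 R) t = b y"
    using S[OF R] xy unfolding strong_bisimulation_pointwise by blast
  \<comment> \<open>The inclusion is the identity map of \<open>?R\<close>, regarded as having the
    larger codomain \<open>?U'\<close>.\<close>
  let ?i = "id_map ?R"
  have i: "?i \<in> ?R \<rightarrow>\<^sub>E ?U'"
    using R by (auto simp: id_map_def elim!: rel_objE)
  have sR: "small ?R" and sU: "small ?U'"
    using small_rel_obj[OF X] subR subU by auto
  have U: "(a, c) \<in> ?U" if "(a, c) \<in> R" for a c using that R by blast
  have c1: "compose ?R (\<pi>1 ?U) ?i = \<pi>1 R" and c2: "compose ?R (\<pi>2 ?U) ?i = \<pi>2 R"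
    using \<pi>1_hom[OF subR] \<pi>2_hom[OF subR]
    by (auto simp: id_map_def U PiE_iff simp del: Union_iff intro!: compose_cong_on elim!: rel_objE)
  show "\<exists>t\<in>Tob M ?U'. Tmap M ?U' X (\<pi>1 ?U) t = b x \<and> Tmap M ?U' X (\<pi>2 ?U) t = b y"
  proof (intro bexI conjI)
    show "Tmap M ?U' X (\<pi>1 ?U) (Tmap M ?R ?U' ?i t) = b x"
      using Tmap_comp_apply[OF sR sU X i \<pi>1_hom[OF subU] t(1)] c1 t by simp
    show "Tmap M ?U' X (\<pi>2 ?U) (Tmap M ?R ?U' ?i t) = b y"
      using Tmap_comp_apply[OF sR sU X i \<pi>2_hom[OF subU] t(1)] c2 t by simp
    show "Tmap M ?R ?U' ?i t \<in> Tob M ?U'"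
      using Tmap_hom[OF sR sU i] t(1) by auto
  qed
qed

text \<open>Lifts are transported along the swap of components \<open>?s\<close>, which interchanges
  the two projections.\<close>

lemma strong_bisimulation_converse:
  assumes X: "small X" and S: "strong_bisimulation M X b R"
  shows "strong_bisimulation M X b (R\<inverse>)"
  unfolding strong_bisimulation_pointwise
proof (intro conjI ballI, safe)
  have sub: "R \<subseteq> X \<times> X" using S unfolding strong_bisimulation_def by blast
  then have subc: "R\<inverse> \<subseteq> X \<times> X" by auto
  show "x \<in> X" "y \<in> X" if "(y, x) \<in> R" for x y
    using that sub by auto
  fix x y assume yx: "(y, x) \<in> R"
  let ?R = "rel_obj R"
  let ?C = "rel_obj (R\<inverse>)"
  obtain t where t: "t \<in> Tob M ?R" "Tmap M ?R X (\<pi>1 R) t = b y" "Tmap M ?R X (\<pi>2 R) t = b x"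
    using S yx unfolding strong_bisimulation_pointwise by blast
  let ?s = "\<lambda>p\<in>?R. pair (psnd p) (pfst p)"
  have s: "?s \<in> ?R \<rightarrow>\<^sub>E ?C"
    by (auto elim!: rel_objE)
  have sR: "small ?R" and sC: "small ?C"
    using small_rel_obj[OF X] sub subc by auto
  have c1: "compose ?R (\<pi>1 (R\<inverse>)) ?s = \<pi>2 R" and c2: "compose ?R (\<pi>2 (R\<inverse>)) ?s = \<pi>1 R"
    using \<pi>1_hom[OF sub] \<pi>2_hom[OF sub]
    by (auto simp: PiE_iff intro!: compose_cong_on elim!: rel_objE)
  show "\<exists>t\<in>Tob M ?C. Tmap M ?C X (\<pi>1 (R\<inverse>)) t = b x \<and> Tmap M ?C X (\<pi>2 (R\<inverse>)) t = b y"
  proof (intro bexI conjI)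
    show "Tmap M ?C X (\<pi>1 (R\<inverse>)) (Tmap M ?R ?C ?s t) = b x"
      using Tmap_comp_apply[OF sR sC X s \<pi>1_hom[OF subc] t(1)] c1 t by simp
    show "Tmap M ?C X (\<pi>2 (R\<inverse>)) (Tmap M ?R ?C ?s t) = b y"
      using Tmap_comp_apply[OF sR sC X s \<pi>2_hom[OF subc] t(1)] c2 t by simp
    show "Tmap M ?R ?C ?s t \<in> Tob M ?C"
      using Tmap_hom[OF sR sC s] t(1) by auto
  qed
qed

end

section \<open>Order enrichment in terms of plain composition\<close>

context order_enriched_monad
begin

text \<open>Here and in the next lemma, monotonicity of Kleisli composition is specialised to
  \<open>sharp\<close>, where the composites reduce to precomposition with \<open>f\<close> and
  postcomposition with \<open>T g\<close>.\<close>

lemma le_compose_map: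
  assumes X: "small X" and Y: "small Y" and Z: "small Z" and f: "f \<in> X \<rightarrow>\<^sub>E Y"
    and g: "g \<in> Y \<rightarrow>\<^sub>E Tob M Z" and g': "g' \<in> Y \<rightarrow>\<^sub>E Tob M Z" and le: "le M Y Z g g'"
  shows "le M X Z (compose X g f) (compose X g' f)"
  using kl_comp_mono_left[OF X Y Z sharp_hom[OF Y f], of g g'] g g' le
  by (simp add: kl_comp_sharp_right[OF Y Z f] kl_hom_def)

lemma le_compose_Tmap:
  assumes X: "small X" and Y: "small Y" and Z: "small Z" and g: "g \<in> Y \<rightarrow>\<^sub>E Z"
    and f: "f \<in> X \<rightarrow>\<^sub>E Tob M Y" and f': "f' \<in> X \<rightarrow>\<^sub>E Tob M Y" and le: "le M X Y f f'"
  shows "le M X Z (compose X (Tmap M Y Z g) f) (compose X (Tmap M Y Z g) f')"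
  using kl_comp_mono_right[OF X Y Z, of f f' "sharp M Y Z g"] sharp_hom[OF Z g] f f' le
  by (simp add: kl_comp_sharp_left[OF Y Z g] kl_hom_def)

end

section \<open>Saturation and weak bisimulations\<close>

context ordered_saturation_monad
begin

text \<open>The saturation of \<open>a\<close> is already reflexive and transitive, so it is its own
  least saturated bound.\<close>

lemma star_star:
  assumes X: "small X" and a: "a \<in> kl_hom M X X"
  shows "star M X (star M X a) = star M X a"
proof -
  note s = star_hom[OF X a]
  note ss = star_hom[OF X s]
  have "le M X X (star M X (star M X a)) (star M X a)"
    using star_least[OF X s s] star_refl[OF X a] star_trans[OF X a] le_refl[OF X X s] by blast
  then show ?thesis
    using le_antisym[OF X X ss s] star_extensive[OF X s] by blast
qed

text \<open>The same structure map \<open>g\<close> serves as witness: the first inequality is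
  \<open>star_extensive\<close> precomposed with \<open>\<pi>1 R\<close>, and the second is an
  equality.\<close>

lemma weak_bisimulation_if_strong:
  assumes X: "small X" and a: "a \<in> X \<rightarrow>\<^sub>E Tob M X" and "sym R"
    and S: "strong_bisimulation M X (star M X a) R"
  shows "weak_bisimulation M X a R"
proof -
  let ?R = "rel_obj R"
  let ?s = "star M X a"
  have a': "a \<in> kl_hom M X X" using a by (simp add: kl_hom_def)
  have s: "?s \<in> X \<rightarrow>\<^sub>E Tob M X" using star_hom[OF X a'] by (simp add: kl_hom_def)
  obtain g where sub: "R \<subseteq> X \<times> X" and g: "g \<in> ?R \<rightarrow>\<^sub>E Tob M ?R"
    and g1: "compose ?R (Tmap M ?R X (\<pi>1 R)) g = compose ?R ?s (\<pi>1 R)"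
    and g2: "compose ?R (Tmap M ?R X (\<pi>2 R)) g = compose ?R ?s (\<pi>2 R)"
    using S unfolding strong_bisimulation_def by blast
  note R = small_rel_obj[OF X sub]
  note p1 = \<pi>1_hom[OF sub]
  note p2 = \<pi>2_hom[OF sub]
  have "le M ?R X (compose ?R a (\<pi>1 R)) (compose ?R ?s (\<pi>1 R))"
    by (rule le_compose_map[OF R X X p1 a s star_extensive[OF X a']])
  moreover have "le M ?R X (compose ?R ?s (\<pi>2 R)) (compose ?R ?s (\<pi>2 R))"
    using le_refl[OF R X] compose_PiE[OF p2 s] by (simp add: kl_hom_def)
  ultimately show ?thesis
    unfolding weak_bisimulation_def
    using sub \<open>sym R\<close> g g1 g2
    by (intro conjI bexI[of _ g])
      (simp_all add: kl_comp_sharp_left[OF R X p1 g] kl_comp_sharp_left[OF R X p2 g]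
        kl_comp_sharp_right[OF X X p1 a] kl_comp_sharp_right[OF X X p2 s])
qed

text \<open>Any map \<open>q\<close> that identifies \<open>R\<close>-related points will do. It
  merges the two projections of \<open>R\<close>, so the bounds obtained for each projection
  separately can be chained.\<close>

lemma weak_bisimulation_quotient_invariant:
  assumes X: "small X" and Y: "small Y" and a: "a \<in> X \<rightarrow>\<^sub>E Tob M X"
    and W: "weak_bisimulation M X a R"
    and q: "q \<in> X \<rightarrow>\<^sub>E Y" and qR: "\<And>x y. (x, y) \<in> R \<Longrightarrow> q x = q y"
    and xy: "(x, y) \<in> R"
  shows "Tmap M X Y q (star M X a x) = Tmap M X Y q (star M X a y)"
proof -
  let ?R = "rel_obj R"
  let ?s = "star M X a"
  let ?q = "Tmap M X Y q"
  have a': "a \<in> kl_hom M X X" using a by (simp add: kl_hom_def)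
  have s': "?s \<in> kl_hom M X X" using star_hom[OF X a'] .
  then have s: "?s \<in> X \<rightarrow>\<^sub>E Tob M X" by (simp add: kl_hom_def)
  from W obtain g where sub: "R \<subseteq> X \<times> X" and sym: "sym R" and g: "g \<in> ?R \<rightarrow>\<^sub>E Tob M ?R"
    and g1: "le M ?R X (kl_comp M ?R X X a (sharp M ?R X (\<pi>1 R)))
      (kl_comp M ?R ?R X (sharp M ?R X (\<pi>1 R)) g)"
    and g2: "le M ?R X (kl_comp M ?R ?R X (sharp M ?R X (\<pi>2 R)) g)
      (kl_comp M ?R X X ?s (sharp M ?R X (\<pi>2 R)))"
    unfolding weak_bisimulation_def by blast
  note R = small_rel_obj[OF X sub]
  note p1 = \<pi>1_hom[OF sub]
  note p2 = \<pi>2_hom[OF sub]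
  have g': "g \<in> kl_hom M ?R ?R" using g by (simp add: kl_hom_def)
  let ?gs = "star M ?R g"
  have gs: "?gs \<in> ?R \<rightarrow>\<^sub>E Tob M ?R" using star_hom[OF R g'] by (simp add: kl_hom_def)
  have l1: "le M ?R X (compose ?R ?s (\<pi>1 R)) (compose ?R (Tmap M ?R X (\<pi>1 R)) ?gs)"
    using star_oplax[OF R X g' a' p1 g1]
    by (simp add: kl_comp_sharp_left[OF R X p1 gs] kl_comp_sharp_right[OF X X p1 s])
  \<comment> \<open>Since \<open>g2\<close> already has the saturation of \<open>a\<close> on the
    right, \<open>star_lax\<close> yields a double star, which \<open>star_star\<close>
    collapses.\<close>
  have l2: "le M ?R X (compose ?R (Tmap M ?R X (\<pi>2 R)) ?gs) (compose ?R ?s (\<pi>2 R))"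
    using star_lax[OF R X g' s' p2 g2]
    by (simp add: star_star[OF X a'] kl_comp_sharp_left[OF R X p2 gs]
        kl_comp_sharp_right[OF X X p2 s])
  let ?u = "compose ?R ?q (compose ?R ?s (\<pi>1 R))"
  let ?v = "compose ?R ?q (compose ?R ?s (\<pi>2 R))"
  let ?m1 = "compose ?R ?q (compose ?R (Tmap M ?R X (\<pi>1 R)) ?gs)"
  let ?m2 = "compose ?R ?q (compose ?R (Tmap M ?R X (\<pi>2 R)) ?gs)"
  note s1 = compose_PiE[OF p1 s]
  note s2 = compose_PiE[OF p2 s]
  note t1 = compose_PiE[OF gs Tmap_hom[OF R X p1]]
  note t2 = compose_PiE[OF gs Tmap_hom[OF R X p2]]
  note Tq = Tmap_hom[OF X Y q]
  have qp: "compose ?R q (\<pi>1 R) = compose ?R q (\<pi>2 R)"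
    by (rule compose_eqI) (auto simp: qR elim!: rel_objE)
  have m: "?m1 = ?m2"
  proof (rule compose_eqI)
    fix p assume p: "p \<in> ?R"
    then have "?gs p \<in> Tob M ?R" using gs by auto
    then show "?q (compose ?R (Tmap M ?R X (\<pi>1 R)) ?gs p)
        = ?q (compose ?R (Tmap M ?R X (\<pi>2 R)) ?gs p)"
      using p Tmap_comp_apply[OF R X Y p1 q] Tmap_comp_apply[OF R X Y p2 q] qp
      by (simp add: compose_eq)
  qed
  have um: "le M ?R Y ?u ?m1"
    by (rule le_compose_Tmap[OF R X Y q s1 t1 l1])
  have mv: "le M ?R Y ?m1 ?v"
    unfolding m by (rule le_compose_Tmap[OF R X Y q t2 s2 l2])
  have hom: "?u \<in> kl_hom M ?R Y" "?m1 \<in> kl_hom M ?R Y" "?v \<in> kl_hom M ?R Y"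
    unfolding kl_hom_def by (rule compose_PiE[OF _ Tq], fact)+
  have uv: "le M ?R Y ?u ?v"
    by (rule le_trans[OF R Y hom um mv])
  \<comment> \<open>As \<open>R\<close> is symmetric, swapping components is an endomap of
    \<open>?R\<close> exchanging \<open>?u\<close> and \<open>?v\<close>. Precomposing with it
    reverses \<open>uv\<close>, and antisymmetry gives equality.\<close>
  let ?sw = "\<lambda>p\<in>?R. pair (psnd p) (pfst p)"
  have sw: "?sw \<in> ?R \<rightarrow>\<^sub>E ?R"
    by (auto elim!: rel_objE intro: symD[OF sym])
  have "le M ?R Y (compose ?R ?u ?sw) (compose ?R ?v ?sw)"
    using le_compose_map[OF R R Y sw _ _ uv] hom by (simp add: kl_hom_def)
  moreover have "compose ?R ?u ?sw = ?v" "compose ?R ?v ?sw = ?u"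
    by (rule compose_eqI, erule rel_objE, simp add: compose_eq symD[OF sym])+
  ultimately have "?u = ?v"
    using le_antisym[OF R Y hom(1,3) uv] by simp
  then have "?u (pair x y) = ?v (pair x y)" by simp
  then show ?thesis using xy by (simp add: compose_eq)
qed

lemma weak_bisimulation_subset_strong:
  assumes P: "weakly_lax_preserves_pullbacks M"
    and X: "small X" and a: "a \<in> X \<rightarrow>\<^sub>E Tob M X" and W: "weak_bisimulation M X a R"
  obtains E where "R \<subseteq> E" "strong_bisimulation M X (star M X a) E"
proof -
  have sub: "R \<subseteq> X \<times> X" and sym: "sym R"
    using W unfolding weak_bisimulation_def by auto
  let ?s = "star M X a"
  have s: "?s \<in> X \<rightarrow>\<^sub>E Tob M X"
    using star_hom[OF X] a by (simp add: kl_hom_def)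
  \<comment> \<open>The quotient is realised inside \<open>X\<close>: \<open>q\<close> selects a
    representative of each class of \<open>R\<^sup>*\<close>, an equivalence since \<open>R\<close>
    is symmetric. \<open>E\<close> is the kernel of \<open>q\<close>.\<close>
  define q where "q = (\<lambda>x\<in>X. SOME y. (x, y) \<in> R\<^sup>*)"
  define E where "E = {(x, y). x \<in> X \<and> y \<in> X \<and> q x = q y}"
  have symr: "sym (R\<^sup>*)" using sym by (rule sym_rtrancl)
  have q_rel: "(x, q x) \<in> R\<^sup>*" if "x \<in> X" for x
    using that someI[of "\<lambda>y. (x, y) \<in> R\<^sup>*" x] by (simp add: q_def)
  have q_eq: "q x = q y" if "(x, y) \<in> R" for x y
  proof -
    \<comment> \<open>Related points have the same candidates for a representative, so
      \<open>SOME\<close> returns the same one.\<close>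
    have "(x, z) \<in> R\<^sup>* \<longleftrightarrow> (y, z) \<in> R\<^sup>*" for z
      using that symD[OF sym that] by (meson converse_rtrancl_into_rtrancl)
    then show ?thesis using that sub by (auto simp: q_def)
  qed
  have closed: "y \<in> X" if "(x, y) \<in> R\<^sup>*" "x \<in> X" for x y
    using that by (induction rule: rtrancl_induct) (use sub in auto)
  have q: "q \<in> X \<rightarrow>\<^sub>E X"
    using closed q_rel by (auto simp: q_def)
  have RE: "R \<subseteq> E" using sub q_eq by (auto simp: E_def)
  have inv: "Tmap M X X q (?s x) = Tmap M X X q (?s y)" if "(x, y) \<in> R\<^sup>*" for x y
    using that
    by (induction rule: rtrancl_induct)
      (use weak_bisimulation_quotient_invariant[OF X X a W q q_eq] in auto)
  have subE: "E \<subseteq> X \<times> X" by (auto simp: E_def)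
  let ?E = "rel_obj E"
  note p1 = \<pi>1_hom[OF subE]
  note p2 = \<pi>2_hom[OF subE]
  have eq: "compose ?E (Tmap M X X q) (compose ?E ?s (\<pi>1 E))
      = compose ?E (Tmap M X X q) (compose ?E ?s (\<pi>2 E))"
  proof (rule compose_eqI)
    fix p assume "p \<in> ?E"
    then obtain x y where p: "p = pair x y" and xy: "(x, y) \<in> E" by (rule rel_objE)
    then have "x \<in> X" "y \<in> X" "q x = q y" by (auto simp: E_def)
    \<comment> \<open>The path runs from \<open>x\<close> to the common representative
      \<open>q x = q y\<close> and back to \<open>y\<close>.\<close>
    then have "(x, y) \<in> R\<^sup>*"
      using q_rel[of x] symD[OF symr q_rel[of y]] by (simp add: rtrancl_trans)
    from inv[OF this] show "Tmap M X X q (compose ?E ?s (\<pi>1 E) p)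
        = Tmap M X X q (compose ?E ?s (\<pi>2 E) p)"
      using p xy by (simp add: compose_eq)
  qed
  have "weak_pullback (Tob M ?E) (Tob M X) (Tob M X) (Tob M X)
      (Tmap M ?E X (\<pi>1 E)) (Tmap M ?E X (\<pi>2 E)) (Tmap M X X q) (Tmap M X X q)"
    using P pullback_kernel_pair[OF X X q E_def]
    unfolding weakly_lax_preserves_pullbacks_def by blast
  \<comment> \<open>The weak pullback is tested on \<open>Z = ?E\<close> with the saturation of
    \<open>a\<close> after each projection; the mediating map \<open>u\<close> is the required
    structure on \<open>E\<close>.\<close>
  then have "\<exists>u. u \<in> ?E \<rightarrow>\<^sub>E Tob M ?E \<and>
      compose ?E (Tmap M ?E X (\<pi>1 E)) u = compose ?E ?s (\<pi>1 E) \<and>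
      compose ?E (Tmap M ?E X (\<pi>2 E)) u = compose ?E ?s (\<pi>2 E)"
    unfolding weak_pullback_def
    using small_rel_obj[OF X subE] compose_PiE[OF p1 s] compose_PiE[OF p2 s] eq by blast
  then have "strong_bisimulation M X ?s E"
    unfolding strong_bisimulation_def using subE by blast
  with RE that show thesis by blast
qed

end

theorem theorem6p8:
  fixes M :: "('u::set_universe, 'm) saturation_data_scheme"
    and X :: "'u set" and \<alpha> :: "'u \<Rightarrow> 'u"
  assumes "ordered_saturation_monad M"
    and "cotupling_monotonic M"
    and "weakly_lax_preserves_pullbacks M"
    and "small X"
    and "\<alpha> \<in> X \<rightarrow>\<^sub>E Tob M X"
  shows "\<exists>R. greatest_relation (weak_bisimulation M X \<alpha>) R \<and>
             greatest_relation (strong_bisimulation M X (star M X \<alpha>)) R"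
proof -
  interpret ordered_saturation_monad M by fact
  let ?strong = "strong_bisimulation M X (star M X \<alpha>)"
  define G where "G = \<Union>{S. ?strong S}"
  have G: "?strong G"
    unfolding G_def by (rule strong_bisimulation_Union[OF \<open>small X\<close>]) simp
  have top: "S \<subseteq> G" if "?strong S" for S
    using that by (auto simp: G_def)
  \<comment> \<open>Weak bisimulations must be symmetric, whereas strong ones need not be; the
    greatest strong one is symmetric because its converse is strong as well.\<close>
  have "G\<inverse> \<subseteq> G"
    by (rule top[OF strong_bisimulation_converse[OF \<open>small X\<close> G]])
  then have "sym G" by (auto simp: sym_def)
  then have "weak_bisimulation M X \<alpha> G"
    using weak_bisimulation_if_strong assms(4,5) G by blast
  \<comment> \<open>A weak bisimulation need not itself be strong, but it lies in a strong one,
    hence in \<open>G\<close>.\<close>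
  moreover have "S \<subseteq> G" if "weak_bisimulation M X \<alpha> S" for S
    by (rule weak_bisimulation_subset_strong[OF assms(3-5) that]) (use top in blast)
  ultimately show ?thesis
    unfolding greatest_relation_def using G top by blast
qed

end
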